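(* Let $m,n$ be positive integers, let $\mathcal{A}^I=[\underline{\mathcal{A}},\overline{\mathcal{A}}]$ be an interval tensor in $T_{m,n}$, and let $\pi\in\mathbb{R}^n$ be a nonnegative vector satisfying $0<\sum_{J\in[n]^{m-1}}\pi_J\le 1$. Then $\mathcal{A}^I$ is an interval $B_{\pi}^{R^I}$-tensor if and only if both of the following hold: (a) $R_i(\underline{\mathcal{A}})>0$ for all $i\in[n]$; (b) for every $i\in[n]$ and every $J\in[n]^{m-1}\setminus\{(i,\dots,i)\}$: (b$_1$) if $0<\pi_J\le 1$, then $$\underline{a}_{ii\cdots i}+\sum_{\substack{K\in[n]^{m-1},\ K\neq J\\ K\neq(i,\dots,i)}}\underline{a}_{iK}>\Bigl(\frac{1}{\pi_J}-1\Bigr)\overline{a}_{iJ};$$ (b$_2$) if $\pi_J=0$, then $0>\overline{a}_{iJ}$.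
   Context: $[n]=\{1,\dots,n\}$. $T_{m,n}$ is the set of real $m$th-order $n$-dimensional tensors $\mathcal{A}=(a_{i_1\cdots i_m})$, $i_1,\dots,i_m\in[n]$. For $J=(i_2,\dots,i_m)\in[n]^{m-1}$ write $a_{iJ}=a_{ii_2\cdots i_m}$. The $i$th row sum is $R_i(\mathcal{A})=\sum_{J\in[n]^{m-1}}a_{iJ}$. For a nonnegative vector $\pi=(\pi_1,\dots,\pi_n)$, $\pi_J:=\pi_{i_2}\cdots\pi_{i_m}$ for $J=(i_2,\dots,i_m)$. A tensor $\mathcal{A}\in T_{m,n}$ is a $B_\pi^R$-tensor (where $\pi$ is a nonnegative vector with $0<\sum_{J\in[n]^{m-1}}\pi_J\le1$ and the superscript $R$ denotes the row sum vector of $\mathcal{A}$ itself) if for all $i\in[n]$: $R_i(\mathcal{A})>0$, and $\pi_JR_i(\mathcal{A})>a_{iJ}$ for all $J\in[n]^{m-1}\setminus\{(i,\dots,i)\}$. For $\underline{\mathcal{A}}=(\underline{a}_{i_1\cdots i_m})\le\overline{\mathcal{A}}=(\overline{a}_{i_1\cdots i_m})$ (componentwise) in $T_{m,n}$, the interval tensor is $\mathcal{A}^I=[\underline{\mathcal{A}},\overline{\mathcal{A}}]=\{\mathcal{A}\in T_{m,n}:\underline{\mathcal{A}}\le\mathcal{A}\le\overline{\mathcal{A}}\}$. It is an interval $B_\pi^{R^I}$-tensor if every $\mathcal{A}\in\mathcal{A}^I$ is a $B_\pi^R$-tensor (same $\pi$, with $R=R(\mathcal{A})$ its own row sum vector).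 *)

theory Defs
  imports Complex_Main "HOL-Library.FuncSet"
begin

definition multi_indices :: "nat \<Rightarrow> nat \<Rightarrow> nat list set" where
  "multi_indices k n = {J. length J = k \<and> set J \<subseteq> {1..n}}"

text \<open>A tensor is a function on multi-indices, made extensional so that each tensor of
  \<open>T\<^sub>m\<^sub>,\<^sub>n\<close> has exactly one representation; the entry \<open>a\<^sub>i\<^sub>J\<close> is \<open>A (i # J)\<close>.\<close>

definition tensors :: "nat \<Rightarrow> nat \<Rightarrow> (nat list \<Rightarrow> real) set" where
  "tensors m n = multi_indices m n \<rightarrow>\<^sub>E UNIV"

definition tensor_le :: "nat \<Rightarrow> nat \<Rightarrow> (nat list \<Rightarrow> real) \<Rightarrow> (nat list \<Rightarrow> real) \<Rightarrow> bool" where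
  "tensor_le m n A B \<longleftrightarrow> (\<forall>I\<in>multi_indices m n. A I \<le> B I)"

definition row_sum :: "nat \<Rightarrow> nat \<Rightarrow> (nat list \<Rightarrow> real) \<Rightarrow> nat \<Rightarrow> real" where
  "row_sum m n A i = (\<Sum>J\<in>multi_indices (m - 1) n. A (i # J))"

definition index_prod :: "(nat \<Rightarrow> real) \<Rightarrow> nat list \<Rightarrow> real" where
  "index_prod \<pi> J = prod_list (map \<pi> J)"

definition admissible_vec :: "nat \<Rightarrow> nat \<Rightarrow> (nat \<Rightarrow> real) \<Rightarrow> bool" where
  "admissible_vec m n \<pi> \<longleftrightarrow>
     \<pi> \<in> {1..n} \<rightarrow>\<^sub>E {0..} \<and>
     0 < (\<Sum>J\<in>multi_indices (m - 1) n. index_prod \<pi> J) \<and>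
     (\<Sum>J\<in>multi_indices (m - 1) n. index_prod \<pi> J) \<le> 1"

definition B_tensor :: "nat \<Rightarrow> nat \<Rightarrow> (nat \<Rightarrow> real) \<Rightarrow> (nat list \<Rightarrow> real) \<Rightarrow> bool" where
  "B_tensor m n \<pi> A \<longleftrightarrow>
     A \<in> tensors m n \<and> admissible_vec m n \<pi> \<and>
     (\<forall>i\<in>{1..n}. row_sum m n A i > 0 \<and>
        (\<forall>J\<in>multi_indices (m - 1) n - {replicate (m - 1) i}.
           index_prod \<pi> J * row_sum m n A i > A (i # J)))"

definition interval_tensor ::
    "nat \<Rightarrow> nat \<Rightarrow> (nat list \<Rightarrow> real) \<Rightarrow> (nat list \<Rightarrow> real) \<Rightarrow> (nat list \<Rightarrow> real) set" where
  "interval_tensor m n L U = {A \<in> tensors m n. tensor_le m n L A \<and> tensor_le m n A U}"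

definition interval_B_tensor ::
    "nat \<Rightarrow> nat \<Rightarrow> (nat \<Rightarrow> real) \<Rightarrow> (nat list \<Rightarrow> real) set \<Rightarrow> bool" where
  "interval_B_tensor m n \<pi> \<A> \<longleftrightarrow> (\<forall>A\<in>\<A>. B_tensor m n \<pi> A)"

end

theory Submission
  imports Defs
begin

text \<open>Fix a row \<open>i\<close> and an off-diagonal position \<open>J\<close>, and split the row sum as
  \<open>R\<^sub>i(A) = a\<^sub>i\<^sub>J + S(A)\<close>, where \<open>S(A)\<close> collects the diagonal entry and all other entries of the row.
  For \<open>\<pi>\<^sub>J > 0\<close> the condition \<open>\<pi>\<^sub>J R\<^sub>i(A) > a\<^sub>i\<^sub>J\<close> is equivalent to
  \<open>S(A) > (1/\<pi>\<^sub>J - 1) a\<^sub>i\<^sub>J\<close> (lemmas \<open>row_sum_split\<close> and \<open>scaled_sum_greater_iff\<close>).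
  As \<open>\<pi>\<^sub>J \<le> 1\<close> (lemma \<open>admissible_vec_index_prod_bounds\<close>), the factor \<open>1/\<pi>\<^sub>J - 1\<close> is nonnegative;
  since \<open>S(A)\<close> does not involve \<open>a\<^sub>i\<^sub>J\<close>, the worst tensor of the interval for this one condition is
  the lower bound \<open>L\<close> with its entry at \<open>(i, J)\<close> raised to that of \<open>U\<close>. That tensor belongs to the
  interval, so the condition at the worst case is necessary as well as sufficient. Likewise the
  worst case for the positivity of the row sums is \<open>L\<close> itself, and for \<open>\<pi>\<^sub>J = 0\<close> the condition
  only says that \<open>a\<^sub>i\<^sub>J < 0\<close>, whose worst case is \<open>U\<close> at \<open>(i, J)\<close>.\<close>

lemma finite_multi_indices: "finite (multi_indices k n)"
proof -
  have "multi_indices k n = {J. set J \<subseteq> {1..n} \<and> length J = k}"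
    by (auto simp: multi_indices_def)
  then show ?thesis
    by (simp add: finite_lists_length_eq)
qed

lemma Cons_in_multi_indices:
  assumes "m \<ge> 1" "i \<in> {1..n}" "J \<in> multi_indices (m - 1) n"
  shows "i # J \<in> multi_indices m n"
  using assms by (auto simp: multi_indices_def)

lemma replicate_in_multi_indices:
  assumes "i \<in> {1..n}"
  shows "replicate k i \<in> multi_indices k n"
  using assms by (auto simp: multi_indices_def)

lemma row_sum_split:
  assumes "m \<ge> 1" "i \<in> {1..n}"
    and J: "J \<in> multi_indices (m - 1) n - {replicate (m - 1) i}"
  shows "row_sum m n A i = A (i # J) + (A (replicate m i)
    + (\<Sum>K\<in>multi_indices (m - 1) n - {J, replicate (m - 1) i}. A (i # K)))"
proof -
  let ?M = "multi_indices (m - 1) n" and ?d = "replicate (m - 1) i"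
  have d: "?d \<in> ?M - {J}"
    using replicate_in_multi_indices[OF assms(2)] J by auto
  have diag: "i # ?d = replicate m i"
    using assms(1) by (cases m) auto
  have "row_sum m n A i = A (i # J) + (\<Sum>K\<in>?M - {J}. A (i # K))"
    unfolding row_sum_def using J by (intro sum.remove finite_multi_indices) auto
  also have "(\<Sum>K\<in>?M - {J}. A (i # K)) = A (i # ?d) + (\<Sum>K\<in>?M - {J} - {?d}. A (i # K))"
    using d by (intro sum.remove finite_Diff finite_multi_indices)
  also have "?M - {J} - {?d} = ?M - {J, ?d}"
    by blast
  finally show ?thesis
    by (simp only: diag)
qed

lemma row_sum_mono:
  assumes "m \<ge> 1" "i \<in> {1..n}" "tensor_le m n A B"
  shows "row_sum m n A i \<le> row_sum m n B i"
  unfolding row_sum_def using assms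
  by (intro sum_mono) (simp add: tensor_le_def Cons_in_multi_indices)

lemma index_prod_nonneg:
  assumes "\<pi> \<in> {1..n} \<rightarrow>\<^sub>E {0..}" "J \<in> multi_indices k n"
  shows "index_prod \<pi> J \<ge> 0"
proof -
  have "\<pi> j \<ge> 0" if "j \<in> set J" for j
  proof -
    have "j \<in> {1..n}"
      using that assms(2) by (auto simp: multi_indices_def)
    then show ?thesis
      using PiE_mem[OF assms(1)] by auto
  qed
  then show ?thesis
    unfolding index_prod_def by (intro prod_list_nonneg) auto
qed

lemma admissible_vec_index_prod_bounds:
  assumes "admissible_vec m n \<pi>" "J \<in> multi_indices (m - 1) n"
  shows "0 \<le> index_prod \<pi> J" "index_prod \<pi> J \<le> 1"
proof -
  have \<pi>: "\<pi> \<in> {1..n} \<rightarrow>\<^sub>E {0..}"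
    and sum_le: "(\<Sum>J\<in>multi_indices (m - 1) n. index_prod \<pi> J) \<le> 1"
    using assms(1) by (auto simp: admissible_vec_def)
  show "0 \<le> index_prod \<pi> J"
    using index_prod_nonneg[OF \<pi> assms(2)] .
  have "index_prod \<pi> J \<le> (\<Sum>J\<in>multi_indices (m - 1) n. index_prod \<pi> J)"
    using index_prod_nonneg[OF \<pi>] assms(2)
    by (intro member_le_sum finite_multi_indices) auto
  then show "index_prod \<pi> J \<le> 1"
    using sum_le by linarith
qed

lemma scaled_sum_greater_iff:
  fixes p a s :: real
  assumes "0 < p"
  shows "p * (a + s) > a \<longleftrightarrow> s > (1 / p - 1) * a"
proof -
  have "p * (a + s) > a \<longleftrightarrow> a + s > a / p"
    using assms by (simp add: pos_divide_less_eq mult.commute)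
  then show ?thesis
    by (auto simp: algebra_simps)
qed

text \<open>The worst-case tensor of the interval for the condition at a single position.\<close>

lemma fun_upd_in_interval_tensor:
  assumes "L \<in> tensors m n" "tensor_le m n L U" "I \<in> multi_indices m n"
  shows "L(I := U I) \<in> interval_tensor m n L U"
proof -
  have "L(I := U I) \<in> tensors m n"
    using assms(1,3) unfolding tensors_def by (auto simp: PiE_iff extensional_def)
  then show ?thesis
    using assms(2) by (auto simp: interval_tensor_def tensor_le_def)
qed

theorem theorem4p1:
  fixes m n :: nat
    and L U :: "nat list \<Rightarrow> real"
    and \<pi> :: "nat \<Rightarrow> real"
  assumes "m \<ge> 1" and "n \<ge> 1"
    and "L \<in> tensors m n" and "U \<in> tensors m n" and "tensor_le m n L U"
    and "admissible_vec m n \<pi>"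
  shows "interval_B_tensor m n \<pi> (interval_tensor m n L U) \<longleftrightarrow>
    (\<forall>i\<in>{1..n}. row_sum m n L i > 0) \<and>
    (\<forall>i\<in>{1..n}. \<forall>J\<in>multi_indices (m - 1) n - {replicate (m - 1) i}.
       (0 < index_prod \<pi> J \<and> index_prod \<pi> J \<le> 1 \<longrightarrow>
          L (replicate m i)
            + (\<Sum>K\<in>multi_indices (m - 1) n - {J, replicate (m - 1) i}. L (i # K))
          > (1 / index_prod \<pi> J - 1) * U (i # J)) \<and>
       (index_prod \<pi> J = 0 \<longrightarrow> 0 > U (i # J)))"
proof -
  define S where "S A i J = A (replicate m i)
      + (\<Sum>K\<in>multi_indices (m - 1) n - {J, replicate (m - 1) i}. A (i # K))"
    for A :: "nat list \<Rightarrow> real" and i J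
  define off where "off i = multi_indices (m - 1) n - {replicate (m - 1) i}" for i
  have split: "row_sum m n A i = A (i # J) + S A i J" if "i \<in> {1..n}" "J \<in> off i" for A i J
    using row_sum_split[OF assms(1) that(1)] that(2) unfolding S_def off_def by blast
  have pos: "i # J \<in> multi_indices m n" if "i \<in> {1..n}" "J \<in> off i" for i J
    using Cons_in_multi_indices[OF assms(1) that(1)] that(2) by (simp add: off_def)
  have bounds: "0 \<le> index_prod \<pi> J" "index_prod \<pi> J \<le> 1" if "J \<in> off i" for i J
    using admissible_vec_index_prod_bounds[OF assms(6)] that by (auto simp: off_def)
  have "interval_B_tensor m n \<pi> (interval_tensor m n L U) \<longleftrightarrow>
    (\<forall>i\<in>{1..n}. row_sum m n L i > 0) \<and>
    (\<forall>i\<in>{1..n}. \<forall>J\<in>off i.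
       (0 < index_prod \<pi> J \<and> index_prod \<pi> J \<le> 1 \<longrightarrow>
          S L i J > (1 / index_prod \<pi> J - 1) * U (i # J)) \<and>
       (index_prod \<pi> J = 0 \<longrightarrow> 0 > U (i # J)))"
    (is "_ \<longleftrightarrow> ?rows \<and> ?entries")
  proof
    assume B: "interval_B_tensor m n \<pi> (interval_tensor m n L U)"
    have "L \<in> interval_tensor m n L U"
      using assms(3,5) by (auto simp: interval_tensor_def tensor_le_def)
    then have ?rows
      using B by (auto simp: interval_B_tensor_def B_tensor_def)
    moreover have "index_prod \<pi> J * (U (i # J) + S L i J) > U (i # J)"
      if i: "i \<in> {1..n}" and J: "J \<in> off i" for i J
    proof -
      let ?A = "L(i # J := U (i # J))"
      have "B_tensor m n \<pi> ?A"
        using B fun_upd_in_interval_tensor[OF assms(3,5) pos[OF i J]]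
        by (simp add: interval_B_tensor_def)
      then have "index_prod \<pi> J * row_sum m n ?A i > ?A (i # J)"
        using i J unfolding B_tensor_def off_def by blast
      moreover have "S ?A i J = S L i J"
      proof -
        have "replicate m i \<noteq> i # J"
          using J assms(1) by (cases m) (auto simp: off_def)
        then show ?thesis
          unfolding S_def by (auto intro: sum.cong)
      qed
      ultimately show ?thesis
        by (simp add: split[OF i J])
    qed
    then have ?entries
      by (fastforce simp: scaled_sum_greater_iff)
    ultimately show "?rows \<and> ?entries" ..
  next
    assume R: "?rows \<and> ?entries"
    have "B_tensor m n \<pi> A" if A: "A \<in> interval_tensor m n L U" for A
    proof -
      have LA: "tensor_le m n L A" and AU: "tensor_le m n A U" and "A \<in> tensors m n"
        using A by (auto simp: interval_tensor_def)
      have rowA: "row_sum m n A i > 0" if "i \<in> {1..n}" for i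
        using R that row_sum_mono[OF assms(1) that LA] by fastforce
      have entryA: "index_prod \<pi> J * row_sum m n A i > A (i # J)"
        if i: "i \<in> {1..n}" and J: "J \<in> off i" for i J
      proof (cases "index_prod \<pi> J = 0")
        case True
        have "A (i # J) \<le> U (i # J)"
          using AU pos[OF i J] by (simp add: tensor_le_def)
        also have "U (i # J) < 0"
          using R i J True by blast
        finally show ?thesis
          using True by simp
      next
        case False
        then have p: "0 < index_prod \<pi> J" "index_prod \<pi> J \<le> 1"
          using bounds[OF J] by auto
        have "(1 / index_prod \<pi> J - 1) * A (i # J) \<le> (1 / index_prod \<pi> J - 1) * U (i # J)"
          using AU pos[OF i J] p by (intro mult_left_mono) (auto simp: tensor_le_def)
        also have "\<dots> < S L i J"
          using R i J p by blast
        also have "S L i J \<le> S A i J"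
          unfolding S_def using LA i assms(1)
          by (intro add_mono sum_mono)
            (auto simp: tensor_le_def Cons_in_multi_indices replicate_in_multi_indices)
        finally show ?thesis
          using p by (simp add: split[OF i J] scaled_sum_greater_iff)
      qed
      show ?thesis
        using rowA entryA \<open>A \<in> tensors m n\<close> assms(6) by (auto simp: B_tensor_def off_def)
    qed
    then show "interval_B_tensor m n \<pi> (interval_tensor m n L U)"
      by (simp add: interval_B_tensor_def)
  qed
  then show ?thesis
    unfolding S_def off_def .
qed

end
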